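(* Assume conditions A and D' hold for the family of stochastic matrices $(p_{ij}(\varepsilon))_{i,j\in\mathbb{X}}$, $\varepsilon\in(0,\varepsilon_0]$. Then for every $r\in\mathbb{X}$ the non-absorption probability $\bar p_{rr}(\varepsilon)=1-p_{rr}(\varepsilon)$ admits a pivotal expansion with explicit power-type remainder bound: there exist integers $0\le\bar l^-_{rr}\le\bar l^+_{rr}$, real coefficients $\bar a_{rr}[l]$, $\bar l^-_{rr}\le l\le\bar l^+_{rr}$, with $\bar a_{rr}[\bar l^-_{rr}]\ne0$, and constants $\bar\delta_{rr}\in(0,1]$, $\bar G_{rr}\in(0,\infty)$, $\bar\varepsilon_{rr}\in(0,\varepsilon_0]$, such that $\big|\bar p_{rr}(\varepsilon)-\sum_{l=\bar l^-_{rr}}^{\bar l^+_{rr}}\bar a_{rr}[l]\varepsilon^l\big|\le\bar G_{rr}\varepsilon^{\bar l^+_{rr}+\bar\delta_{rr}}$ for $0<\varepsilon\le\bar\varepsilon_{rr}$.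
   Context: Let $\mathbb{X}=\{1,\dots,N\}$, $0<\varepsilon_0\le1$, and for each $\varepsilon\in(0,\varepsilon_0]$ let $(p_{ij}(\varepsilon))_{i,j\in\mathbb{X}}$ be a stochastic matrix (transition probabilities of a Markov chain). Condition A: there are nonempty sets $\mathbb{Y}_i\subseteq\mathbb{X}$, $i\in\mathbb{X}$, such that (a) $p_{ij}(\varepsilon)>0$ for $j\in\mathbb{Y}_i$, $i\in\mathbb{X}$, $\varepsilon\in(0,\varepsilon_0]$; (b) $p_{ij}(\varepsilon)=0$ for $j\notin\mathbb{Y}_i$, $i\in\mathbb{X}$, $\varepsilon\in(0,\varepsilon_0]$; (c) for every $i,j\in\mathbb{X}$ there exist $n\ge1$ and states $i=l_0,l_1,\dots,l_n=j$ with $l_m\in\mathbb{Y}_{l_{m-1}}$ for $m=1,\dots,n$. Condition D': for all $i\in\mathbb{X}$, $j\in\mathbb{Y}_i$, $p_{ij}(\varepsilon)=\sum_{l=l^-_{ij}}^{l^+_{ij}}a_{ij}[l]\varepsilon^l+o_{ij}(\varepsilon)$ for $\varepsilon\in(0,\varepsilon_0]$, where $0\le l^-_{ij}\le l^+_{ij}<\infty$ are integers, $a_{ij}[l^-_{ij}]>0$, and $|o_{ij}(\varepsilon)|\le G_{ij}\varepsilon^{l^+_{ij}+\delta_{ij}}$ for $0<\varepsilon\le\varepsilon_{ij}$, with $\delta_{ij}\in(0,1]$, $G_{ij}\in(0,\infty)$, $\varepsilon_{ij}\in(0,\varepsilon_0]$. *)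

theory Defs
  imports Complex_Main
begin

definition stochastic_family :: "nat \<Rightarrow> real \<Rightarrow> (real \<Rightarrow> nat \<Rightarrow> nat \<Rightarrow> real) \<Rightarrow> bool" where
  "stochastic_family N eps0 p \<longleftrightarrow>
     (\<forall>eps. 0 < eps \<and> eps \<le> eps0 \<longrightarrow>
        (\<forall>i\<in>{1..N}. (\<forall>j\<in>{1..N}. 0 \<le> p eps i j) \<and> (\<Sum>j=1..N. p eps i j) = 1))"

definition condition_A :: "nat \<Rightarrow> real \<Rightarrow> (real \<Rightarrow> nat \<Rightarrow> nat \<Rightarrow> real) \<Rightarrow> (nat \<Rightarrow> nat set) \<Rightarrow> bool" where
  "condition_A N eps0 p Y \<longleftrightarrow>
     (\<forall>i\<in>{1..N}. Y i \<noteq> {} \<and> Y i \<subseteq> {1..N}) \<and>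
     (\<forall>eps. 0 < eps \<and> eps \<le> eps0 \<longrightarrow>
        (\<forall>i\<in>{1..N}. \<forall>j\<in>Y i. p eps i j > 0)) \<and>
     (\<forall>eps. 0 < eps \<and> eps \<le> eps0 \<longrightarrow>
        (\<forall>i\<in>{1..N}. \<forall>j\<in>{1..N}. j \<notin> Y i \<longrightarrow> p eps i j = 0)) \<and>
     (\<forall>i\<in>{1..N}. \<forall>j\<in>{1..N}. \<exists>n::nat. \<exists>l::nat \<Rightarrow> nat.
        n \<ge> 1 \<and> l 0 = i \<and> l n = j \<and> (\<forall>m\<in>{1..n}. l m \<in> Y (l (m - 1))))"

definition expansion_with_bound ::
  "real \<Rightarrow> (real \<Rightarrow> real) \<Rightarrow> nat \<Rightarrow> nat \<Rightarrow> (nat \<Rightarrow> real) \<Rightarrow> real \<Rightarrow> real \<Rightarrow> real \<Rightarrow> bool" where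
  "expansion_with_bound eps0 f lm lp a \<delta> G e \<longleftrightarrow>
     lm \<le> lp \<and> 0 < \<delta> \<and> \<delta> \<le> 1 \<and> 0 < G \<and> 0 < e \<and> e \<le> eps0 \<and>
     (\<forall>eps. 0 < eps \<and> eps \<le> e \<longrightarrow>
        \<bar>f eps - (\<Sum>l=lm..lp. a l * eps ^ l)\<bar> \<le> G * eps powr (real lp + \<delta>))"

definition condition_D' :: "nat \<Rightarrow> real \<Rightarrow> (real \<Rightarrow> nat \<Rightarrow> nat \<Rightarrow> real) \<Rightarrow> (nat \<Rightarrow> nat set) \<Rightarrow> bool" where
  "condition_D' N eps0 p Y \<longleftrightarrow>
     (\<forall>i\<in>{1..N}. \<forall>j\<in>Y i. \<exists>lm lp a \<delta> G e.
        expansion_with_bound eps0 (\<lambda>eps. p eps i j) lm lp a \<delta> G e \<and> a lm > 0)"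

end

theory Submission
  imports Defs
begin

text \<open>Since the chain is stochastic and cannot jump outside Y r, the non-absorption probability
  1 - p r r is the sum of the p r j over j \<in> Y r - {r}; irreducibility and N \<ge> 2 make this index
  set nonempty. Each summand has an expansion with positive leading coefficient; cutting all of
  them down to the smallest lower order, the smallest upper order and the smallest remainder
  exponent gives expansions of a common shape, which add up. The leading coefficient of the sum
  is a sum of nonnegative terms, at least one of them positive, so it does not vanish.\<close>

lemma expansion_with_bound_cong:
  assumes "expansion_with_bound eps0 f lm lp a \<delta> G e"
    and "\<And>eps. 0 < eps \<Longrightarrow> eps \<le> eps0 \<Longrightarrow> f eps = g eps"
  shows "expansion_with_bound eps0 g lm lp a \<delta> G e"
  using assms unfolding expansion_with_bound_def by force

lemma expansion_with_bound_lower_start: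
  assumes "expansion_with_bound eps0 f lm1 lp a \<delta> G e" and "lm \<le> lm1"
  shows "expansion_with_bound eps0 f lm lp (\<lambda>l. if lm1 \<le> l then a l else 0) \<delta> G e"
proof -
  have "(\<Sum>l=lm..lp. (if lm1 \<le> l then a l else 0) * eps ^ l) = (\<Sum>l=lm1..lp. a l * eps ^ l)"
    for eps :: real
  proof -
    have "(\<Sum>l=lm..lp. (if lm1 \<le> l then a l else 0) * eps ^ l)
        = (\<Sum>l\<in>{lm..lp}. if l \<in> {lm1..} then a l * eps ^ l else 0)"
      by (rule sum.cong) auto
    also have "\<dots> = (\<Sum>l\<in>{lm..lp} \<inter> {lm1..}. a l * eps ^ l)"
      by (rule sum.inter_restrict[symmetric]) simp
    also have "{lm..lp} \<inter> {lm1..} = {lm1..lp}" using \<open>lm \<le> lm1\<close> by auto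
    finally show ?thesis .
  qed
  then show ?thesis using assms unfolding expansion_with_bound_def by auto
qed

lemma expansion_with_bound_truncate:
  assumes "expansion_with_bound eps0 f lm lp1 a \<delta>1 G e" and "eps0 \<le> 1"
    and "lm \<le> lp" "lp \<le> lp1" "0 < \<delta>" "\<delta> \<le> \<delta>1"
  shows "expansion_with_bound eps0 f lm lp a \<delta> (G + (\<Sum>l=Suc lp..lp1. \<bar>a l\<bar>)) e"
proof -
  from assms(1) have G: "0 < G" and e: "0 < e" "e \<le> eps0" and \<delta>1: "\<delta>1 \<le> 1"
    and bound: "\<And>eps. 0 < eps \<Longrightarrow> eps \<le> e \<Longrightarrow>
        \<bar>f eps - (\<Sum>l=lm..lp1. a l * eps ^ l)\<bar> \<le> G * eps powr (real lp1 + \<delta>1)"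
    unfolding expansion_with_bound_def by auto
  define H where "H = (\<Sum>l=Suc lp..lp1. \<bar>a l\<bar>)"
  have "\<bar>f eps - (\<Sum>l=lm..lp. a l * eps ^ l)\<bar> \<le> (G + H) * eps powr (real lp + \<delta>)"
    if eps: "0 < eps" "eps \<le> e" for eps
  proof -
    have "eps \<le> 1" using eps e \<open>eps0 \<le> 1\<close> by linarith
    \<comment> \<open>the dropped monomials have exponent at least lp + 1 \<ge> lp + \<delta>, and eps \<le> 1\<close>
    have tail_term: "\<bar>a l * eps ^ l\<bar> \<le> \<bar>a l\<bar> * eps powr (real lp + \<delta>)"
      if "l \<in> {Suc lp..lp1}" for l
    proof -
      have "eps ^ l = eps powr real l" using eps by (simp add: powr_realpow)
      also have "\<dots> \<le> eps powr (real lp + \<delta>)"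
        using that \<open>eps \<le> 1\<close> eps assms(6) \<delta>1 by (intro powr_mono') auto
      finally show ?thesis using eps by (simp add: abs_mult mult_left_mono)
    qed
    have "\<bar>\<Sum>l=Suc lp..lp1. a l * eps ^ l\<bar> \<le> (\<Sum>l=Suc lp..lp1. \<bar>a l * eps ^ l\<bar>)"
      by (rule sum_abs)
    also have "\<dots> \<le> (\<Sum>l=Suc lp..lp1. \<bar>a l\<bar> * eps powr (real lp + \<delta>))"
      by (rule sum_mono) (rule tail_term)
    finally have tail: "\<bar>\<Sum>l=Suc lp..lp1. a l * eps ^ l\<bar> \<le> H * eps powr (real lp + \<delta>)"
      by (simp add: H_def sum_distrib_right)
    have "G * eps powr (real lp1 + \<delta>1) \<le> G * eps powr (real lp + \<delta>)"
      using G eps \<open>eps \<le> 1\<close> assms(4,6) by (intro mult_left_mono powr_mono') auto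
    moreover have "(\<Sum>l=lm..lp1. a l * eps ^ l)
        = (\<Sum>l=lm..lp. a l * eps ^ l) + (\<Sum>l=Suc lp..lp1. a l * eps ^ l)"
    proof -
      have "{lm..lp1} = {lm..lp} \<union> {Suc lp..lp1}" using assms(3,4) by auto
      then show ?thesis by (simp add: sum.union_disjoint)
    qed
    ultimately show ?thesis using bound[OF eps] tail by (simp add: distrib_right)
  qed
  moreover have "0 < G + H" using G by (simp add: H_def add_pos_nonneg sum_nonneg)
  ultimately show ?thesis
    using assms e unfolding expansion_with_bound_def H_def[symmetric] by auto
qed

lemma expansion_with_bound_sum:
  assumes "finite J" "J \<noteq> {}"
    and "\<forall>j\<in>J. expansion_with_bound eps0 (F j) lm lp (a j) \<delta> (G j) (e j)"
  shows "expansion_with_bound eps0 (\<lambda>eps. \<Sum>j\<in>J. F j eps) lm lp (\<lambda>l. \<Sum>j\<in>J. a j l) \<delta>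
           (\<Sum>j\<in>J. G j) (Min (e ` J))"
proof -
  obtain j0 where "j0 \<in> J" using assms(2) by auto
  have e_min: "Min (e ` J) \<le> e j" if "j \<in> J" for j
    using assms(1) that by simp
  have "\<bar>(\<Sum>j\<in>J. F j eps) - (\<Sum>l=lm..lp. (\<Sum>j\<in>J. a j l) * eps ^ l)\<bar>
      \<le> (\<Sum>j\<in>J. G j) * eps powr (real lp + \<delta>)"
    if eps: "0 < eps" "eps \<le> Min (e ` J)" for eps
  proof -
    have "(\<Sum>j\<in>J. F j eps) - (\<Sum>l=lm..lp. (\<Sum>j\<in>J. a j l) * eps ^ l)
        = (\<Sum>j\<in>J. F j eps - (\<Sum>l=lm..lp. a j l * eps ^ l))"
      by (simp add: sum_subtractf sum_distrib_right sum.swap[of _ J])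
    also have "\<bar>\<dots>\<bar> \<le> (\<Sum>j\<in>J. \<bar>F j eps - (\<Sum>l=lm..lp. a j l * eps ^ l)\<bar>)"
      by (rule sum_abs)
    also have "\<dots> \<le> (\<Sum>j\<in>J. G j * eps powr (real lp + \<delta>))"
    proof (rule sum_mono)
      fix j assume "j \<in> J"
      then show "\<bar>F j eps - (\<Sum>l=lm..lp. a j l * eps ^ l)\<bar> \<le> G j * eps powr (real lp + \<delta>)"
        using assms(3) eps e_min[of j] unfolding expansion_with_bound_def by auto
    qed
    finally show ?thesis by (simp add: sum_distrib_right)
  qed
  moreover have "0 < (\<Sum>j\<in>J. G j)"
    using assms by (intro sum_pos) (auto simp: expansion_with_bound_def)
  moreover have "0 < Min (e ` J)"
    using assms by (auto simp: expansion_with_bound_def)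
  ultimately show ?thesis
    using assms(3) \<open>j0 \<in> J\<close> e_min[OF \<open>j0 \<in> J\<close>]
    unfolding expansion_with_bound_def by fastforce
qed

lemma sum_of_expansions_with_positive_leading_coefficients:
  assumes "finite J" "J \<noteq> {}" "eps0 \<le> 1"
    and "\<forall>j\<in>J. expansion_with_bound eps0 (F j) (lm j) (lp j) (a j) (\<delta> j) (G j) (e j)
                 \<and> a j (lm j) > 0"
  shows "\<exists>lm' lp' a' \<delta>' G' e'.
           expansion_with_bound eps0 (\<lambda>eps. \<Sum>j\<in>J. F j eps) lm' lp' a' \<delta>' G' e' \<and> a' lm' > 0"
proof -
  define Lm where "Lm = Min (lm ` J)"
  define Lp where "Lp = Min (lp ` J)"
  define d where "d = Min (\<delta> ` J)"
  define b where "b = (\<lambda>j l. if lm j \<le> l then a j l else 0)"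
  have Lm: "Lm \<le> lm j" and Lp: "Lp \<le> lp j" and d: "d \<le> \<delta> j" if "j \<in> J" for j
    using assms(1) that by (simp_all add: Lm_def Lp_def d_def)
  have "Lm \<in> lm ` J" "Lp \<in> lp ` J" "d \<in> \<delta> ` J"
    using assms(1,2) unfolding Lm_def Lp_def d_def by (simp_all add: Min_in)
  then obtain jm jp jd where jm: "jm \<in> J" "lm jm = Lm" and jp: "jp \<in> J" "lp jp = Lp"
    and jd: "jd \<in> J" "\<delta> jd = d"
    by (metis imageE)
  have "Lm \<le> Lp" using assms(4) jp Lm[OF jp(1)] unfolding expansion_with_bound_def by force
  have "0 < d" using assms(4) jd unfolding expansion_with_bound_def by force
  have common: "\<forall>j\<in>J. expansion_with_bound eps0 (F j) Lm Lp (b j) d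
                   (G j + (\<Sum>l=Suc Lp..lp j. \<bar>b j l\<bar>)) (e j)"
  proof
    fix j assume j: "j \<in> J"
    have "expansion_with_bound eps0 (F j) Lm (lp j) (b j) (\<delta> j) (G j) (e j)"
      unfolding b_def
      by (rule expansion_with_bound_lower_start) (use assms(4) j Lm[OF j] in auto)
    then show "expansion_with_bound eps0 (F j) Lm Lp (b j) d
                 (G j + (\<Sum>l=Suc Lp..lp j. \<bar>b j l\<bar>)) (e j)"
      by (rule expansion_with_bound_truncate)
        (use assms(3) \<open>Lm \<le> Lp\<close> \<open>0 < d\<close> Lp[OF j] d[OF j] in auto)
  qed
  \<comment> \<open>b j Lm is a j (lm j) if lm j = Lm, and 0 otherwise\<close>
  have "0 \<le> b j Lm" if "j \<in> J" for j
    using assms(4) that Lm[OF that] by (auto simp: b_def)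
  moreover have "0 < b jm Lm" using assms(4) jm by (auto simp: b_def)
  ultimately have "0 < (\<Sum>j\<in>J. b j Lm)"
    using assms(1) jm(1) by (intro sum_pos2) auto
  with expansion_with_bound_sum[OF assms(1,2) common] show ?thesis by blast
qed

lemma path_leaves_start:
  fixes n :: nat
  assumes "l 0 = r" "l n \<noteq> r" "\<forall>m\<in>{1..n}. l m \<in> Y (l (m - 1))"
  shows "\<exists>j\<in>Y r. j \<noteq> r"
  using assms
proof (induction n)
  case 0
  then show ?case by simp
next
  case (Suc n)
  show ?case
  proof (cases "l n = r")
    case True
    then show ?thesis using Suc.prems(2,3) by force
  next
    case False
    then show ?thesis using Suc by auto
  qed
qed

lemma condition_A_leaves_state:
  assumes "N \<ge> 2" "condition_A N eps0 p Y" "r \<in> {1..N}"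
  shows "Y r - {r} \<noteq> {}"
proof -
  define j :: nat where "j = (if r = 1 then 2 else 1)"
  have j: "j \<in> {1..N}" "j \<noteq> r" using assms(1,3) by (auto simp: j_def)
  then obtain n :: nat and l where "l 0 = r" "l n = j" "\<forall>m\<in>{1..n}. l m \<in> Y (l (m - 1))"
    using assms(2,3) unfolding condition_A_def by blast
  then show ?thesis using j(2) path_leaves_start[of l r n Y] by auto
qed

lemma one_minus_diagonal_eq_sum:
  assumes "stochastic_family N eps0 p" "condition_A N eps0 p Y" "r \<in> {1..N}"
    and "0 < eps" "eps \<le> eps0"
  shows "1 - p eps r r = (\<Sum>j\<in>Y r - {r}. p eps r j)"
proof -
  have Y: "Y r \<subseteq> {1..N}" and zero: "\<forall>j\<in>{1..N}. j \<notin> Y r \<longrightarrow> p eps r j = 0"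
    using assms(2-5) unfolding condition_A_def by auto
  have "1 = (\<Sum>j=1..N. p eps r j)"
    using assms(1,3-5) unfolding stochastic_family_def by auto
  also have "\<dots> = p eps r r + (\<Sum>j\<in>{1..N} - {r}. p eps r j)"
    using assms(3) by (simp add: sum.remove)
  also have "(\<Sum>j\<in>{1..N} - {r}. p eps r j) = (\<Sum>j\<in>Y r - {r}. p eps r j)"
    using Y zero by (intro sum.mono_neutral_right) auto
  finally show ?thesis by simp
qed

theorem lemma5:
  fixes N :: nat and eps0 :: real and p :: "real \<Rightarrow> nat \<Rightarrow> nat \<Rightarrow> real"
    and Y :: "nat \<Rightarrow> nat set"
  assumes "N \<ge> 2"
    and "0 < eps0" and "eps0 \<le> 1"
    and "stochastic_family N eps0 p"
    and "condition_A N eps0 p Y"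
    and "condition_D' N eps0 p Y"
    and "r \<in> {1..N}"
  shows "\<exists>lm lp a \<delta> G e.
           expansion_with_bound eps0 (\<lambda>eps. 1 - p eps r r) lm lp a \<delta> G e \<and> a lm \<noteq> 0"
proof -
  define J where "J = Y r - {r}"
  have "finite J"
    using assms(5,7) unfolding J_def condition_A_def
    by (meson finite_Diff finite_atLeastAtMost finite_subset)
  have "J \<noteq> {}" using condition_A_leaves_state[OF assms(1,5,7)] by (simp add: J_def)
  have "\<forall>j\<in>J. \<exists>lm lp a \<delta> G e.
      expansion_with_bound eps0 (\<lambda>eps. p eps r j) lm lp a \<delta> G e \<and> a lm > 0"
    using assms(6,7) unfolding condition_D'_def J_def by auto
  then obtain lm lp a \<delta> G e where "\<forall>j\<in>J.
      expansion_with_bound eps0 (\<lambda>eps. p eps r j) (lm j) (lp j) (a j) (\<delta> j) (G j) (e j) \<and> a j (lm j) > 0"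
    by metis
  then have "\<exists>lm' lp' a' \<delta>' G' e'. expansion_with_bound eps0 (\<lambda>eps. \<Sum>j\<in>J. p eps r j)
      lm' lp' a' \<delta>' G' e' \<and> a' lm' > 0"
    by (rule sum_of_expansions_with_positive_leading_coefficients[OF \<open>finite J\<close> \<open>J \<noteq> {}\<close> assms(3)])
  then obtain lm' lp' a' \<delta>' G' e' where
    sum: "expansion_with_bound eps0 (\<lambda>eps. \<Sum>j\<in>J. p eps r j) lm' lp' a' \<delta>' G' e'"
    and "a' lm' > 0"
    by blast
  have "(\<Sum>j\<in>J. p eps r j) = 1 - p eps r r" if "0 < eps" "eps \<le> eps0" for eps
    using one_minus_diagonal_eq_sum[OF assms(4,5,7) that] by (simp add: J_def)
  then have "expansion_with_bound eps0 (\<lambda>eps. 1 - p eps r r) lm' lp' a' \<delta>' G' e'"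
    by (rule expansion_with_bound_cong[OF sum])
  with \<open>a' lm' > 0\<close> show ?thesis by force
qed

end
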